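(* For $c_{t,\delta}=c^\ast-\frac{D}{M^{3/2}}\,\delta\,t^{-1/2}$, $0\le\delta<K$, where $K$ is a positive constant, we have $$u^{[\mathcal{M}]}_{\alpha,t}(c_{t,\delta})=\frac{D}{M^{3/2}}\,x_\alpha(\delta)\sqrt t\,\big(1+o(1)\big),\qquad t\to\infty,$$ where $x_\alpha(\delta)$ is a solution $x$ to the equation $$1-\Phi(-\delta+x)+\Phi(-\delta-x)\exp\{2\delta x\}=\alpha.$$
   Context: $M>0$ and $D>0$ are fixed constants (in the underlying renewal model with inter-renewal time $T$ and jump size $Y$, $M=\mathsf{E}T/\mathsf{E}Y$ and $D^2=((\mathsf{E}T)^2\,\mathsf{D}Y+(\mathsf{E}Y)^2\,\mathsf{D}T)/(\mathsf{E}Y)^3$, $\mathsf{D}$ denoting variance), $c^\ast=M^{-1}$, and $\alpha$ is fixed, positive and reasonably small (e.g. $\alpha=0.05$). For $u,t,c>0$, $$\mathcal{M}_{u,c}(t)=\int_0^{ct/u}\frac{1}{x+1}\,\varphi_{\left(cM(x+1),\,\frac{c^2D^2}{u}(x+1)\right)}(x)\,dx,$$ where $\varphi_{(a,b^2)}(x)$ is the density at $x$ of the normal distribution with mean $a$ and variance $b^2$. The heuristic fixed-probability level $u^{[\mathcal{M}]}_{\alpha,t}(c)$ is a positive solution, with respect to $u$, of the equation $\mathcal{M}_{u,c}(t)=\alpha$. $\Phi$ is the standard normal c.d.f.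
   Formalization: The positive solution u is not unique: for large t a second root stays bounded, near 2Φ(M√u/D)−1=α, and violates the asymptotics; the formal claim covers all solutions above some constant u₀>0 and proves that they exist. *)

theory Defs
  imports "HOL-Probability.Probability"
begin

definition std_normal_cdf :: "real \<Rightarrow> real" where
  "std_normal_cdf z = cdf std_normal_distribution z"

text \<open>
  The second argument of \<^const>\<open>normal_density\<close> is the standard deviation, hence the
  square root of the variance.
\<close>

definition inv_gauss_approx :: "real \<Rightarrow> real \<Rightarrow> real \<Rightarrow> real \<Rightarrow> real \<Rightarrow> real" where
  "inv_gauss_approx M D u c t =
     integral {0..c * t / u}
       (\<lambda>x. 1 / (x + 1) *
            normal_density (c * M * (x + 1)) (sqrt (c\<^sup>2 * D\<^sup>2 / u * (x + 1))) x)"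

text \<open>
  A heuristic fixed-probability level is a positive solution in \<open>u\<close>. The solution is not
  unique: the approximation tends to \<open>0\<close> both for \<open>u \<rightarrow> 0\<close> and for \<open>u \<rightarrow> \<infinity>\<close>.
  For \<open>c\<close> near \<open>1 / M\<close> and large \<open>t\<close> a spurious solution stays bounded, near the root of
  \<open>2 * \<Phi> (M * sqrt u / D) - 1 = \<alpha>\<close>, so asymptotic claims about levels have to exclude it.
\<close>

definition is_fixed_prob_level ::
    "real \<Rightarrow> real \<Rightarrow> real \<Rightarrow> real \<Rightarrow> real \<Rightarrow> real \<Rightarrow> bool" where
  "is_fixed_prob_level M D \<alpha> t c u \<longleftrightarrow> u > 0 \<and> inv_gauss_approx M D u c t = \<alpha>"

definition c_near_crit :: "real \<Rightarrow> real \<Rightarrow> real \<Rightarrow> real \<Rightarrow> real" where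
  "c_near_crit M D t \<delta> = 1 / M - D / M powr (3/2) * \<delta> * t powr (- 1/2)"

definition solves_limit_eq :: "real \<Rightarrow> real \<Rightarrow> real \<Rightarrow> bool" where
  "solves_limit_eq \<alpha> \<delta> x \<longleftrightarrow>
     1 - std_normal_cdf (- \<delta> + x) + std_normal_cdf (- \<delta> - x) * exp (2 * \<delta> * x) = \<alpha>"

end

theory Submission
  imports Defs "HOL-Real_Asymp.Real_Asymp"
begin

text \<open>
  The integrand is an inverse Gaussian density in \<open>x + 1\<close>, so the integral is elementary: with
  \<open>G p q = \<Phi> (p - q) + exp (2 p q) \<Phi> (- p - q)\<close>, the probability that Brownian motion with drift
  \<open>p\<close> reaches \<open>q\<close> before time \<open>1\<close>, it is a difference of two values of \<open>G\<close>, and the limit equation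
  reads \<open>G \<delta> x = \<alpha>\<close>. For \<open>u = D / M powr (3/2) * y * sqrt t\<close> the first value tends to \<open>G \<delta> y\<close>
  uniformly on compact sets. The second tends to \<open>0\<close> as \<open>u\<close> grows, so it is harmless once
  \<open>u\<close> exceeds a suitable constant.
  The bounds \<open>2 \<Phi> (- q) \<le> G p q \<le> 2 \<Phi> (p - q)\<close> confine the levels to a compact range of \<open>y\<close>, on which
  \<open>G \<delta>\<close> is strictly decreasing, and compactness turns convergence of the values into uniform
  convergence of the levels.
\<close>

section \<open>Calculus of the standard normal c.d.f\<close>

lemma measure_std_normal_Ioc:
  "measure std_normal_distribution {x<..y} = (LINT z:{x<..y}|lborel. std_normal_density z)"
  unfolding set_lebesgue_integral_def
  using integral_density[of "indicator {x<..y} :: real \<Rightarrow> real" lborel std_normal_density]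
  by (simp add: mult.commute)

text \<open>Near \<open>x\<close> the c.d.f. differs by a constant from the integral of the
  continuous density over \<open>{x - 1..z}\<close>, so the fundamental theorem of calculus
  applies.\<close>

lemma std_normal_cdf_has_real_derivative:
  "(std_normal_cdf has_real_derivative std_normal_density x) (at x)"
proof -
  let ?a = "x - 1" and ?b = "x + 1"
  have cont: "continuous_on S std_normal_density" for S
    unfolding std_normal_density_def by (intro continuous_intros) auto
  have eq: "std_normal_cdf ?a + integral {?a..z} std_normal_density = std_normal_cdf z"
    if "z \<in> {?a<..<?b}" for z
  proof -
    interpret real_distribution std_normal_distribution
      by (rule real_dist_normal_dist)
    have "std_normal_cdf z - std_normal_cdf ?a = measure std_normal_distribution {?a<..z}"
      unfolding std_normal_cdf_def using that by (intro cdf_diff_eq) auto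
    also have "\<dots> = (LINT y:{?a<..z}|lborel. std_normal_density y)"
      by (rule measure_std_normal_Ioc)
    also have "\<dots> = (LINT y:{?a..z}|lborel. std_normal_density y)"
    proof (rule set_integral_cong_set)
      show "AE y in lborel. (y \<in> {?a..z}) = (y \<in> {?a<..z})"
        using AE_lborel_singleton[of ?a] by eventually_elim auto
    qed (auto simp: set_borel_measurable_def)
    also have "\<dots> = integral {?a..z} std_normal_density"
    proof (rule set_borel_integral_eq_integral)
      show "set_integrable lborel {?a..z} std_normal_density"
        unfolding set_integrable_def by (rule integrable_mult_indicator) simp_all
    qed
    finally show ?thesis by linarith
  qed
  have "((\<lambda>z. integral {?a..z} std_normal_density) has_real_derivative std_normal_density x)
      (at x within {?a..?b})"
    by (intro integral_has_real_derivative cont) auto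
  then have "((\<lambda>z. integral {?a..z} std_normal_density) has_real_derivative std_normal_density x) (at x)"
    using at_within_Icc_at[of ?a x ?b] by simp
  then have "((\<lambda>z. std_normal_cdf ?a + integral {?a..z} std_normal_density)
      has_real_derivative std_normal_density x) (at x)"
    using DERIV_add[OF DERIV_const] by fastforce
  then show ?thesis
    by (rule has_field_derivative_transform_within_open[where S = "{?a<..<?b}"]) (simp_all add: eq)
qed

lemmas std_normal_cdf_has_real_derivative' [derivative_intros] =
  DERIV_chain2[OF std_normal_cdf_has_real_derivative]

lemma std_normal_density_has_real_derivative [derivative_intros]:
  assumes "(f has_real_derivative f') (at x within S)"
  shows "((\<lambda>x. std_normal_density (f x)) has_real_derivative
    - f x * std_normal_density (f x) * f') (at x within S)"
  unfolding std_normal_density_def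
  by (rule derivative_eq_intros assms refl | simp)+

lemma continuous_on_std_normal_cdf [continuous_intros]:
  assumes "continuous_on S f"
  shows "continuous_on S (\<lambda>x. std_normal_cdf (f x))"
proof -
  have "continuous_on UNIV std_normal_cdf"
    using std_normal_cdf_has_real_derivative
    by (intro continuous_at_imp_continuous_on ballI DERIV_isCont)
  then show ?thesis
    using assms by (rule continuous_on_compose2) auto
qed

lemma std_normal_cdf_at_bot: "(std_normal_cdf \<longlongrightarrow> 0) at_bot"
  and std_normal_cdf_at_top: "(std_normal_cdf \<longlongrightarrow> 1) at_top"
proof -
  interpret real_distribution std_normal_distribution
    by (rule real_dist_normal_dist)
  have eq: "std_normal_cdf = cdf std_normal_distribution"
    by (simp add: std_normal_cdf_def fun_eq_iff)
  show "(std_normal_cdf \<longlongrightarrow> 0) at_bot" "(std_normal_cdf \<longlongrightarrow> 1) at_top"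
    unfolding eq by (rule cdf_lim_at_bot cdf_lim_at_top_prob)+
qed

lemma std_normal_density_pos: "std_normal_density x > 0"
  by (simp add: normal_density_pos)

lemma std_normal_cdf_less: "x < y \<Longrightarrow> std_normal_cdf x < std_normal_cdf y"
  by (erule DERIV_pos_imp_increasing)
    (use std_normal_cdf_has_real_derivative std_normal_density_pos in blast)

lemma std_normal_cdf_le: "x \<le> y \<Longrightarrow> std_normal_cdf x \<le> std_normal_cdf y"
  using std_normal_cdf_less[of x y] by (cases "x = y") auto

lemma std_normal_cdf_pos: "std_normal_cdf x > 0"
  by (rule DERIV_pos_imp_increasing_at_bot[OF _ std_normal_cdf_at_bot])
    (use std_normal_cdf_has_real_derivative std_normal_density_pos in blast)

lemma std_normal_density_minus: "std_normal_density (- x) = std_normal_density x"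
  by (simp add: std_normal_density_def)

lemma std_normal_cdf_minus: "std_normal_cdf (- x) = 1 - std_normal_cdf x"
proof -
  let ?f = "\<lambda>x. std_normal_cdf x + std_normal_cdf (- x)"
  have "\<forall>x. (?f has_real_derivative 0) (at x)"
    by (auto intro!: derivative_eq_intros simp: std_normal_density_minus)
  then have const: "?f = (\<lambda>_. ?f x)"
    using DERIV_isconst_all by blast
  have "(?f \<longlongrightarrow> 1 + 0) at_top"
    by (intro tendsto_add std_normal_cdf_at_top
        filterlim_compose[OF std_normal_cdf_at_bot] filterlim_uminus_at_bot_at_top)
  then have "((\<lambda>_::real. ?f x) \<longlongrightarrow> 1) at_top"
    using const by simp
  then have "?f x = 1"
    by (simp add: tendsto_const_iff)
  then show ?thesis by simp
qed

lemma std_normal_cdf_0: "std_normal_cdf 0 = 1 / 2"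
  using std_normal_cdf_minus[of 0] by simp

section \<open>Mills ratio estimates\<close>

lemma std_normal_density_at_bot: "((\<lambda>x. - (std_normal_density x / x)) \<longlongrightarrow> 0) at_bot"
  unfolding std_normal_density_def by real_asymp

text \<open>The gap between the two sides vanishes at minus infinity and has the positive derivative
  \<open>std_normal_density y / y\<^sup>2\<close>.\<close>

lemma mills_bound:
  assumes "x < 0"
  shows "std_normal_cdf x < - (std_normal_density x / x)"
proof -
  let ?f = "\<lambda>x. - (std_normal_density x / x) - std_normal_cdf x"
  have "((\<lambda>x. - (std_normal_density x / x) - std_normal_cdf x) \<longlongrightarrow> 0 - 0) at_bot"
    by (intro tendsto_diff std_normal_cdf_at_bot std_normal_density_at_bot)
  moreover have "\<exists>d. (?f has_real_derivative d) (at y) \<and> d > 0" if "y \<le> x" for y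
  proof (intro exI conjI)
    from that assms have "y < 0" by simp
    then show "(?f has_real_derivative std_normal_density y / y\<^sup>2) (at y)"
      by (auto intro!: derivative_eq_intros simp: field_simps power2_eq_square)
    show "std_normal_density y / y\<^sup>2 > 0"
      using std_normal_density_pos \<open>y < 0\<close> by simp
  qed
  ultimately have "0 < ?f x"
    using DERIV_pos_imp_increasing_at_bot[of x ?f 0] by simp
  then show ?thesis by simp
qed

lemma mills_pos: "x * std_normal_cdf x + std_normal_density x > 0"
proof (cases "x < 0")
  case True
  then show ?thesis
    using mills_bound[OF True] by (simp add: field_simps)
next
  case False
  then show ?thesis
    using std_normal_cdf_pos[of x] std_normal_density_pos[of x]
    by (simp add: add_nonneg_pos)
qed

text \<open>The derivative of the ratio is the quantity of \<open>mills_pos\<close> divided by the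
  density. Since \<open>exp (2 * p * q)\<close> is a quotient of two densities, this monotonicity is
  what compares the two summands of \<open>crossing_prob\<close>.\<close>

lemma mills_ratio_mono:
  assumes "x \<le> y"
  shows "std_normal_cdf x / std_normal_density x \<le> std_normal_cdf y / std_normal_density y"
proof (rule DERIV_nonneg_imp_nondecreasing[OF assms])
  fix z :: real
  let ?d = "1 + z * std_normal_cdf z / std_normal_density z"
  have "((\<lambda>x. std_normal_cdf x / std_normal_density x) has_real_derivative ?d) (at z)"
    using std_normal_density_pos[of z]
    by (auto intro!: derivative_eq_intros simp: field_simps)
  moreover have "?d \<ge> 0"
    using mills_pos[of z] std_normal_density_pos[of z] by (simp add: field_simps)
  ultimately show "\<exists>d. ((\<lambda>x. std_normal_cdf x / std_normal_density x) has_real_derivative d) (at z) \<and> d \<ge> 0"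
    by blast
qed

section \<open>First passage probability of Brownian motion with drift\<close>

text \<open>The formula is kept for all real \<open>q\<close>, although it is a probability only for
  \<open>q \<ge> 0\<close>: the limit equation does not restrict the sign of its unknown.\<close>

definition crossing_prob :: "real \<Rightarrow> real \<Rightarrow> real" where
  "crossing_prob p q = std_normal_cdf (p - q) + exp (2 * p * q) * std_normal_cdf (- p - q)"

lemma solves_limit_eq_iff: "solves_limit_eq \<alpha> \<delta> x \<longleftrightarrow> crossing_prob \<delta> x = \<alpha>"
proof -
  have "1 - std_normal_cdf (- \<delta> + x) = std_normal_cdf (\<delta> - x)"
    using std_normal_cdf_minus[of "- \<delta> + x"] by simp
  then show ?thesis
    unfolding solves_limit_eq_def crossing_prob_def by (simp only: mult.commute)
qed

text \<open>The squares of \<open>p + q\<close> and \<open>p - q\<close> differ by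
  \<open>4 * p * q\<close>. The identity removes the exponential wherever it multiplies a density,
  in particular in every derivative of \<open>crossing_prob\<close> below.\<close>

lemma exp_times_std_normal_density:
  "exp (2 * p * q) * std_normal_density (- p - q) = std_normal_density (p - q)"
proof -
  have "2 * p * q + - (- p - q)\<^sup>2 / 2 = - (p - q)\<^sup>2 / 2"
    by (simp add: power2_eq_square field_simps)
  then show ?thesis
    unfolding std_normal_density_def by (simp flip: exp_add)
qed

text \<open>Excludes roots \<open>x \<le> 0\<close> of the limit equation, as \<alpha> < 1. The
  first summand is \<open>1 - std_normal_cdf (q - p)\<close>, and the Mills ratio at
  \<open>q - p\<close> and \<open>- p - q\<close> shows that the second summand makes up for the
  loss.\<close>

lemma crossing_prob_ge_1:
  assumes "p \<ge> 0" and "q \<le> 0"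
  shows "crossing_prob p q \<ge> 1"
proof -
  have "std_normal_cdf (q - p) / std_normal_density (q - p)
      \<le> std_normal_cdf (- p - q) / std_normal_density (- p - q)"
    using assms by (intro mills_ratio_mono) simp
  moreover have "std_normal_density (q - p) = exp (2 * p * q) * std_normal_density (- p - q)"
    using exp_times_std_normal_density[of p q] std_normal_density_minus[of "p - q"] by simp
  ultimately have "std_normal_cdf (q - p) \<le> exp (2 * p * q) * std_normal_cdf (- p - q)"
    using std_normal_density_pos[of "- p - q"] by (simp add: field_simps)
  then show ?thesis
    using std_normal_cdf_minus[of "p - q"] by (simp add: crossing_prob_def)
qed

text \<open>Because \<open>- p - q \<le> p - q\<close>, monotonicity of the Mills ratio bounds the
  second summand by the first.\<close>

lemma crossing_prob_le:
  assumes "q \<ge> 0" and "p \<ge> 0"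
  shows "crossing_prob p q \<le> 2 * std_normal_cdf (p - q)"
proof -
  have "std_normal_cdf (- p - q) / std_normal_density (- p - q)
      \<le> std_normal_cdf (p - q) / std_normal_density (p - q)"
    using assms by (intro mills_ratio_mono) simp
  then have "exp (2 * p * q) * std_normal_cdf (- p - q) \<le> std_normal_cdf (p - q)"
    using std_normal_density_pos[of "- p - q"]
    unfolding exp_times_std_normal_density[of p q, symmetric] by (simp add: field_simps)
  then show ?thesis
    by (simp add: crossing_prob_def)
qed

lemma crossing_prob_pos: "crossing_prob p q > 0"
  by (simp add: crossing_prob_def std_normal_cdf_pos add_pos_pos)

text \<open>In the derivative with respect to \<open>p\<close> the density terms cancel and a
  nonnegative term is left, so the drift may be lowered to 0, where both summands equal
  \<open>std_normal_cdf (- q)\<close>.\<close>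

lemma crossing_prob_ge:
  assumes "q \<ge> 0" and "p \<ge> 0"
  shows "crossing_prob p q \<ge> 2 * std_normal_cdf (- q)"
proof -
  have "crossing_prob 0 q \<le> crossing_prob p q"
  proof (rule DERIV_nonneg_imp_nondecreasing[OF \<open>p \<ge> 0\<close>])
    fix x
    let ?d = "2 * q * exp (2 * x * q) * std_normal_cdf (- x - q)"
    have "((\<lambda>p. crossing_prob p q) has_real_derivative
        std_normal_density (x - q) + (?d - exp (2 * x * q) * std_normal_density (- x - q))) (at x)"
      unfolding crossing_prob_def
      by (rule derivative_eq_intros refl | simp)+
    then have "((\<lambda>p. crossing_prob p q) has_real_derivative ?d) (at x)"
      unfolding exp_times_std_normal_density by simp
    moreover have "?d \<ge> 0"
      using \<open>q \<ge> 0\<close> std_normal_cdf_pos[of "- x - q"] by simp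
    ultimately show "\<exists>d. ((\<lambda>p. crossing_prob p q) has_real_derivative d) (at x) \<and> d \<ge> 0"
      by blast
  qed
  then show ?thesis
    by (simp add: crossing_prob_def)
qed

text \<open>With respect to the level the density terms add up instead of cancelling. They win
  because \<open>mills_bound\<close> at \<open>- p - x\<close> controls the exponential term even
  with the factor \<open>p + x\<close> in place of \<open>p\<close>.\<close>

lemma crossing_prob_strict_antimono:
  assumes "p \<ge> 0" and "0 < q" and "q < r"
  shows "crossing_prob p r < crossing_prob p q"
proof (rule DERIV_neg_imp_decreasing[OF \<open>q < r\<close>])
  fix x assume "q \<le> x" "x \<le> r"
  with assms have x: "x > 0" by simp
  let ?d = "2 * p * (exp (2 * p * x) * std_normal_cdf (- p - x)) - 2 * std_normal_density (p - x)"
  have "(crossing_prob p has_real_derivative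
      - std_normal_density (p - x) + (2 * p * (exp (2 * p * x) * std_normal_cdf (- p - x))
        - exp (2 * p * x) * std_normal_density (- p - x))) (at x)"
    unfolding crossing_prob_def
    by (rule derivative_eq_intros refl | simp)+
  then have "(crossing_prob p has_real_derivative ?d) (at x)"
    unfolding exp_times_std_normal_density by (simp add: algebra_simps)
  moreover have "?d < 0"
  proof -
    have "(p + x) * std_normal_cdf (- p - x) < std_normal_density (- p - x)"
      using mills_bound[of "- p - x"] assms x by (simp add: field_simps)
    then have "exp (2 * p * x) * ((p + x) * std_normal_cdf (- p - x))
        < exp (2 * p * x) * std_normal_density (- p - x)"
      by simp
    then have "(p + x) * (exp (2 * p * x) * std_normal_cdf (- p - x)) < std_normal_density (p - x)"
      unfolding exp_times_std_normal_density by (simp add: algebra_simps)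
    moreover have "p * (exp (2 * p * x) * std_normal_cdf (- p - x))
        \<le> (p + x) * (exp (2 * p * x) * std_normal_cdf (- p - x))"
      using x std_normal_cdf_pos[of "- p - x"] by (intro mult_right_mono) auto
    ultimately show ?thesis by linarith
  qed
  ultimately show "\<exists>d. (crossing_prob p has_real_derivative d) (at x) \<and> d < 0"
    by blast
qed

lemma continuous_on_crossing_prob [continuous_intros]:
  assumes "continuous_on S f" and "continuous_on S g"
  shows "continuous_on S (\<lambda>x. crossing_prob (f x) (g x))"
  unfolding crossing_prob_def by (intro continuous_intros assms)

section \<open>Closed form of the integral\<close>

text \<open>The two arguments of \<open>crossing_prob\<close> in \<open>?F\<close> have the product
  \<open>a\<^sup>2 * b\<close>, which does not depend on \<open>x\<close>. The exponential factor is
  thus constant, only density terms survive in the derivative of \<open>?F\<close>, and they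
  collapse to the integrand. The two values belong to the upper end \<open>s - 1\<close> and to
  0.\<close>

lemma inv_gauss_approx_eq:
  fixes M D u c t :: real
  assumes "D > 0" "u > 0" "c > 0" "t > 0"
  defines "a \<equiv> sqrt u / (c * D)" and "b \<equiv> 1 - c * M" and "s \<equiv> 1 + c * t / u"
  shows "inv_gauss_approx M D u c t =
    crossing_prob (a * b * sqrt s) (a / sqrt s) - crossing_prob (a * b) a"
proof -
  let ?F = "\<lambda>x. crossing_prob (a * b * sqrt (x + 1)) (a / sqrt (x + 1))"
  have "a > 0" using assms by (simp add: a_def)
  have deriv: "(?F has_real_derivative 1 / (x + 1) *
      normal_density (c * M * (x + 1)) (sqrt (c\<^sup>2 * D\<^sup>2 / u * (x + 1))) x) (at x)" if "x \<ge> 0" for x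
  proof -
    define r where "r = sqrt (x + 1)"
    have r: "r > 0" "r\<^sup>2 = x + 1" using that by (auto simp: r_def)
    let ?p = "a * b * r" and ?q = "a / r"
    let ?E = "exp (2 * ?p * ?q)"
    have sq: "((\<lambda>x. sqrt (x + 1)) has_real_derivative inverse r / 2) (at x)"
      using that by (auto intro!: derivative_eq_intros simp: r_def)
    have p': "((\<lambda>x. a * b * sqrt (x + 1)) has_real_derivative a * b / (2 * r)) (at x)"
      by (rule derivative_eq_intros sq refl | simp add: field_simps)+
    have q': "((\<lambda>x. a / sqrt (x + 1)) has_real_derivative - a / (2 * r ^ 3)) (at x)"
    proof -
      have "((\<lambda>x. a / sqrt (x + 1)) has_real_derivative (0 * r - a * (inverse r / 2)) / (r * r)) (at x)"
        using DERIV_divide[OF DERIV_const sq, of a] r(1) by (simp add: r_def)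
      also have "(0 * r - a * (inverse r / 2)) / (r * r) = - a / (2 * r ^ 3)"
        using r(1) by (simp add: field_simps power3_eq_cube)
      finally show ?thesis .
    qed
    let ?p' = "a * b / (2 * r)" and ?q' = "- a / (2 * r ^ 3)"
    have zero: "2 * ?p' * ?q + 2 * ?p * ?q' = 0"
      using r(1) by (simp add: field_simps power3_eq_cube)
    have "(?F has_real_derivative std_normal_density (?p - ?q) * (?p' - ?q')
        + (?E * (2 * ?p' * ?q + 2 * ?p * ?q') * std_normal_cdf (- ?p - ?q)
          + ?E * std_normal_density (- ?p - ?q) * (- ?p' - ?q'))) (at x)"
      unfolding crossing_prob_def
      by (rule derivative_eq_intros p' q' refl | simp only: r_def)+ (simp add: algebra_simps)
    then have "(?F has_real_derivative std_normal_density (?p - ?q) * (a / r ^ 3)) (at x)"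
      unfolding zero exp_times_std_normal_density by (simp add: field_simps)
    moreover have "1 / (x + 1) *
        normal_density (c * M * (x + 1)) (sqrt (c\<^sup>2 * D\<^sup>2 / u * (x + 1))) x
        = std_normal_density (?p - ?q) * (a / r ^ 3)"
    proof -
      \<comment> \<open>With standard deviation \<open>r / a\<close> and deviation
        \<open>b * r\<^sup>2 - 1\<close> from the mean, the standardised variable is exactly
        \<open>?p - ?q\<close>.\<close>
      have sigma: "sqrt (c\<^sup>2 * D\<^sup>2 / u * (x + 1)) = r / a"
        using r \<open>a > 0\<close> assms(1-3)
        by (intro real_sqrt_unique) (simp_all add: a_def power_divide power_mult_distrib)
      have mean: "x - c * M * (x + 1) = b * r\<^sup>2 - 1"
        by (simp add: r b_def algebra_simps)
      have "(b * r\<^sup>2 - 1)\<^sup>2 / (2 * (r / a)\<^sup>2) = (?p - ?q)\<^sup>2 / 2"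
        using r(1) \<open>a > 0\<close> by (simp add: field_simps power2_eq_square)
      moreover have "sqrt (2 * pi * (r / a)\<^sup>2) = sqrt (2 * pi) * (r / a)"
        using r(1) \<open>a > 0\<close> by (simp add: real_sqrt_mult)
      ultimately have "normal_density (c * M * (x + 1)) (sqrt (c\<^sup>2 * D\<^sup>2 / u * (x + 1))) x
          = 1 / (sqrt (2 * pi) * (r / a)) * exp (- ((?p - ?q)\<^sup>2 / 2))"
        unfolding normal_density_def sigma mean by simp
      also have "\<dots> = std_normal_density (?p - ?q) * (a / r)"
        unfolding std_normal_density_def by simp
      finally show ?thesis
        unfolding r(2)[symmetric] by (simp add: power2_eq_square power3_eq_cube)
    qed
    ultimately show ?thesis by simp
  qed
  have "((\<lambda>x. 1 / (x + 1) * normal_density (c * M * (x + 1)) (sqrt (c\<^sup>2 * D\<^sup>2 / u * (x + 1))) x)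
      has_integral ?F (c * t / u) - ?F 0) {0..c * t / u}"
    using assms deriv
    by (intro fundamental_theorem_of_calculus)
      (auto simp flip: has_real_derivative_iff_has_vector_derivative intro: has_field_derivative_at_within)
  then show ?thesis
    unfolding inv_gauss_approx_def s_def by (simp add: integral_unique add.commute)
qed

section \<open>Rescaling\<close>

text \<open>
  The approximation in the coordinates \<open>\<tau> = D / sqrt (M * t)\<close> and
  \<open>y = M powr (3/2) * u / (D * sqrt t)\<close>, for \<open>c = c_near_crit M D t \<delta>\<close>.
\<close>

definition scaled_approx :: "real \<Rightarrow> real \<Rightarrow> real \<Rightarrow> real" where
  "scaled_approx \<delta> y \<tau> =
    crossing_prob (\<delta> * sqrt (1 - \<delta> * \<tau> + y * \<tau>) / (1 - \<delta> * \<tau>))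
      (y / ((1 - \<delta> * \<tau>) * sqrt (1 - \<delta> * \<tau> + y * \<tau>))) -
    crossing_prob (\<delta> * \<tau> * (sqrt (y / \<tau>) / (1 - \<delta> * \<tau>))) (sqrt (y / \<tau>) / (1 - \<delta> * \<tau>))"

lemma powr_three_halves:
  fixes x :: real
  assumes "x > 0"
  shows "x powr (3/2) = x * sqrt x"
proof -
  have "x powr (3/2) = x powr (1 + 1/2)" by simp
  also have "\<dots> = x * sqrt x"
    using assms by (subst powr_add) (simp add: powr_half_sqrt)
  finally show ?thesis .
qed

lemma c_near_crit_eq:
  assumes "M > 0" "t > 0"
  shows "c_near_crit M D t \<delta> = (1 - \<delta> * (D / sqrt (M * t))) / M"
proof -
  have "t powr (- 1/2) = 1 / sqrt t"
    using powr_minus[of t "1/2"] assms by (simp add: powr_half_sqrt inverse_eq_divide)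
  then show ?thesis
    using assms by (simp add: c_near_crit_def powr_three_halves real_sqrt_mult field_simps)
qed

text \<open>After rescaling, \<open>M\<close> and \<open>D\<close> enter only through \<tau> and
  \<open>y\<close>. The quotient \<open>y / \<tau> = (M / D)\<^sup>2 * u\<close> is free of
  \<open>t\<close>, so a fixed lower bound for \<open>u\<close> is a fixed lower bound for
  \<open>y / \<tau>\<close>.\<close>

lemma inv_gauss_approx_eq_scaled_approx:
  assumes "M > 0" "D > 0" "t > 0" "u > 0"
  defines "\<tau> \<equiv> D / sqrt (M * t)"
  assumes "\<delta> * \<tau> < 1"
  shows "inv_gauss_approx M D u (c_near_crit M D t \<delta>) t = scaled_approx \<delta> (M\<^sup>2 * u * \<tau> / D\<^sup>2) \<tau>"
proof -
  \<comment> \<open>\<open>w\<close> is \<open>c * M\<close>, and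
    \<open>\<delta> * \<tau> < 1\<close> makes \<open>c\<close> positive.\<close>
  define w where "w = 1 - \<delta> * \<tau>"
  define y where "y = M\<^sup>2 * u * \<tau> / D\<^sup>2"
  define a where "a = sqrt (y / \<tau>) / w"
  have pos: "w > 0" "\<tau> > 0" "y > 0"
    using assms by (simp_all add: w_def \<tau>_def y_def)
  have c: "c_near_crit M D t \<delta> = w / M"
    using c_near_crit_eq[OF \<open>M > 0\<close> \<open>t > 0\<close>] by (simp add: w_def \<tau>_def)
  have "y / \<tau> = (M / D)\<^sup>2 * u"
    using pos by (simp add: y_def power_divide)
  then have "sqrt (y / \<tau>) = M / D * sqrt u"
    using assms(1,2) by (simp add: real_sqrt_mult)
  then have a: "sqrt u / (w / M * D) = a"
    using pos assms(1,2) by (simp add: a_def field_simps)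
  have "\<tau>\<^sup>2 = D\<^sup>2 / (M * t)"
    using assms(1,3) by (simp add: \<tau>_def power_divide)
  then have t: "t = D\<^sup>2 / (M * \<tau>\<^sup>2)"
    using assms(1-3) pos by (simp add: field_simps)
  have u: "u = D\<^sup>2 * y / (M\<^sup>2 * \<tau>)"
    using assms(1,2) pos by (simp add: y_def field_simps)
  have "t / u = M / (y * \<tau>)"
    by (subst t, subst u) (use assms(1,2) pos in \<open>simp add: power2_eq_square\<close>)
  then have s: "1 + w / M * t / u = (w + y * \<tau>) / (y * \<tau>)"
    using assms(1,4) pos by (simp add: field_simps)
  define m where "m = w + y * \<tau>"
  have m: "m > 0" using pos by (simp add: m_def add_pos_pos)
  have "sqrt (y / \<tau>) * sqrt (m / (y * \<tau>)) = sqrt (m / \<tau>\<^sup>2)"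
    using pos by (simp add: power2_eq_square flip: real_sqrt_mult)
  then have p: "a * (\<delta> * \<tau>) * sqrt (m / (y * \<tau>)) = \<delta> * sqrt m / w"
    using pos m by (simp add: a_def real_sqrt_divide field_simps)
  have "sqrt (y / \<tau>) / sqrt (m / (y * \<tau>)) = sqrt (y\<^sup>2 / m)"
    using pos m by (simp add: power2_eq_square flip: real_sqrt_divide)
  then have q: "a / sqrt (m / (y * \<tau>)) = y / (w * sqrt m)"
    using pos m by (simp add: a_def real_sqrt_divide field_simps)
  have b: "1 - w / M * M = \<delta> * \<tau>"
    using assms(1) by (simp add: w_def)
  have "inv_gauss_approx M D u (w / M) t =
      crossing_prob (a * (\<delta> * \<tau>) * sqrt (m / (y * \<tau>))) (a / sqrt (m / (y * \<tau>)))
      - crossing_prob (a * (\<delta> * \<tau>)) a"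
    using inv_gauss_approx_eq[of D u "w / M" t M] assms(1-4) pos
    unfolding a b s m_def by simp
  moreover have "scaled_approx \<delta> y \<tau> =
      crossing_prob (\<delta> * sqrt m / w) (y / (w * sqrt m)) - crossing_prob (a * (\<delta> * \<tau>)) a"
    unfolding scaled_approx_def m_def a_def w_def by (simp add: mult.commute)
  ultimately show ?thesis
    unfolding c p q y_def[symmetric] by simp
qed

section \<open>Bounds uniform in the small parameter\<close>

text \<open>Bounds the value at the lower end of integration. As
  \<open>\<delta> * \<tau> \<le> 1 / 2\<close>, the drift is at most half of the level
  \<open>a\<close>, and \<open>a \<ge> sqrt (y / \<tau>)\<close>. In the original coordinates the
  bound depends on \<open>u\<close> but not on \<open>t\<close>.\<close>

lemma crossing_prob_start_le:
  assumes "\<delta> \<ge> 0" "\<tau> > 0" "\<delta> * \<tau> \<le> 1 / 2" "y > 0"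
  shows "crossing_prob (\<delta> * \<tau> * (sqrt (y / \<tau>) / (1 - \<delta> * \<tau>))) (sqrt (y / \<tau>) / (1 - \<delta> * \<tau>))
    \<le> 2 * std_normal_cdf (- sqrt (y / \<tau>) / 2)"
proof -
  define a where "a = sqrt (y / \<tau>) / (1 - \<delta> * \<tau>)"
  have "sqrt (y / \<tau>) \<ge> 0" and "1 - \<delta> * \<tau> > 0" and "1 - \<delta> * \<tau> \<le> 1"
    using assms by simp_all
  then have a: "a \<ge> sqrt (y / \<tau>)"
    unfolding a_def by (simp add: pos_le_divide_eq mult_left_le)
  with \<open>sqrt (y / \<tau>) \<ge> 0\<close> have "a \<ge> 0" by linarith
  then have "crossing_prob (\<delta> * \<tau> * a) a \<le> 2 * std_normal_cdf (\<delta> * \<tau> * a - a)"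
    using assms by (intro crossing_prob_le) auto
  moreover have "\<delta> * \<tau> * a \<le> 1 / 2 * a"
    using assms \<open>a \<ge> 0\<close> by (intro mult_right_mono) auto
  then have "std_normal_cdf (\<delta> * \<tau> * a - a) \<le> std_normal_cdf (- sqrt (y / \<tau>) / 2)"
    using a by (intro std_normal_cdf_le) linarith
  ultimately show ?thesis
    unfolding a_def by linarith
qed

text \<open>Serves small \<open>y\<close>; \<open>crossing_prob_ge\<close> removes the drift. The
  factor 3 arises from \<open>w \<ge> 1 / 2\<close> and \<open>sqrt m \<ge> 2 / 3\<close>, hence
  \<open>y / (w * sqrt m) \<le> 3 * y\<close>.\<close>

lemma scaled_approx_ge:
  assumes "\<delta> \<ge> 0" "\<tau> > 0" "\<delta> * \<tau> \<le> 1 / 2" "y > 0"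
  shows "scaled_approx \<delta> y \<tau> \<ge> 2 * std_normal_cdf (- 3 * y) - 2 * std_normal_cdf (- sqrt (y / \<tau>) / 2)"
proof -
  define w where "w = 1 - \<delta> * \<tau>"
  define m where "m = w + y * \<tau>"
  have w: "w \<ge> 1 / 2" using assms by (simp add: w_def)
  have m: "m \<ge> 1 / 2" using assms w by (simp add: m_def add_increasing2)
  have "sqrt m \<ge> 2 / 3"
    using m by (intro real_le_rsqrt) (simp add: power2_eq_square)
  then have "1 / 2 * (2 / 3) \<le> w * sqrt m"
    using w by (intro mult_mono) auto
  then have "y / (w * sqrt m) \<le> y / (1 / 3)"
    using assms by (intro divide_left_mono) auto
  then have "2 * std_normal_cdf (- 3 * y) \<le> 2 * std_normal_cdf (- (y / (w * sqrt m)))"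
    by (simp add: std_normal_cdf_le)
  also have "\<dots> \<le> crossing_prob (\<delta> * sqrt m / w) (y / (w * sqrt m))"
    using assms w m by (intro crossing_prob_ge) auto
  finally show ?thesis
    using crossing_prob_start_le[OF assms] unfolding scaled_approx_def m_def w_def by linarith
qed

text \<open>Serves large \<open>y\<close>; the subtracted value is positive and is dropped. The 6
  comes from level minus drift being \<open>(y - \<delta> * m) / (w * sqrt m)\<close>, with
  numerator at least \<open>y / 4\<close> and denominator at most
  \<open>3 / 2 * sqrt y\<close>.\<close>

lemma scaled_approx_le:
  assumes "\<delta> \<ge> 0" "0 < \<tau>" "\<tau> \<le> 1" "\<delta> * \<tau> \<le> 1 / 2" "y \<ge> 4 * \<delta>" "y \<ge> 1"
  shows "scaled_approx \<delta> y \<tau> \<le> 2 * std_normal_cdf (- sqrt y / 6)"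
proof -
  define w where "w = 1 - \<delta> * \<tau>"
  define m where "m = w + y * \<tau>"
  have w: "w \<ge> 1 / 2" "w \<le> 1" using assms by (simp_all add: w_def)
  have "y * \<tau> \<le> y" using assms by (simp add: mult_left_le)
  then have m: "m \<ge> 1 / 2" "m \<le> 2 * y"
    using assms w by (simp add: m_def add_increasing2, unfold m_def, linarith)
  have "sqrt 2 \<le> 3 / 2"
    by (intro real_le_lsqrt) (auto simp: power2_eq_square)
  have "w * sqrt m \<le> 1 * sqrt (2 * y)"
    using w m by (intro mult_mono) auto
  also have "\<dots> \<le> 3 / 2 * sqrt y"
    using \<open>sqrt 2 \<le> 3 / 2\<close> assms by (simp add: real_sqrt_mult mult_right_mono)
  finally have "sqrt y / 6 * (w * sqrt m) \<le> sqrt y / 6 * (3 / 2 * sqrt y)"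
    using assms by (intro mult_left_mono) auto
  also have "\<dots> = y / 4" using assms by simp
  \<comment> \<open>Of \<open>y\<close>, at most a quarter is lost to \<delta> and a half to
    \<open>\<delta> * \<tau> * y\<close>.\<close>
  also have "y / 4 \<le> y - \<delta> * m"
  proof -
    have "\<delta> * m \<le> \<delta> * (1 + y * \<tau>)"
      using assms w by (intro mult_left_mono) (auto simp: m_def)
    also have "\<dots> = \<delta> + (\<delta> * \<tau>) * y" by (simp add: algebra_simps)
    also have "(\<delta> * \<tau>) * y \<le> 1 / 2 * y"
      using assms by (intro mult_right_mono) auto
    finally show ?thesis using assms by simp
  qed
  finally have "sqrt y / 6 \<le> (y - \<delta> * m) / (w * sqrt m)"
    using w m by (simp add: pos_le_divide_eq)
  also have "(y - \<delta> * m) / (w * sqrt m) = y / (w * sqrt m) - \<delta> * sqrt m / w"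
    using w m by (simp add: field_simps)
  finally have "2 * std_normal_cdf (\<delta> * sqrt m / w - y / (w * sqrt m)) \<le> 2 * std_normal_cdf (- sqrt y / 6)"
    by (simp add: std_normal_cdf_le)
  moreover have "crossing_prob (\<delta> * sqrt m / w) (y / (w * sqrt m))
      \<le> 2 * std_normal_cdf (\<delta> * sqrt m / w - y / (w * sqrt m))"
    using assms w m by (intro crossing_prob_le) auto
  ultimately show ?thesis
    using crossing_prob_pos[of "\<delta> * \<tau> * (sqrt (y / \<tau>) / (1 - \<delta> * \<tau>))"]
    unfolding scaled_approx_def m_def w_def by smt
qed

section \<open>Uniform convergence and uniform inversion\<close>

text \<open>The first value extends continuously to \<open>\<tau> = 0\<close>, where it equals
  \<open>crossing_prob \<delta> y\<close>, so uniform continuity on a compact box applies. For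
  \<open>y \<ge> \<eta>\<close> the second is at most
  \<open>2 * std_normal_cdf (- sqrt (\<eta> / \<tau>) / 2)\<close>, which vanishes with
  \<tau>.\<close>

lemma scaled_approx_uniform_limit:
  assumes "K > 0" "0 < \<eta>" "\<epsilon> > 0"
  shows "\<forall>\<^sub>F \<tau> in at_right 0. \<forall>\<delta>\<in>{0..K}. \<forall>y\<in>{\<eta>..Y}.
    \<bar>scaled_approx \<delta> y \<tau> - crossing_prob \<delta> y\<bar> < \<epsilon>"
proof -
  \<comment> \<open>This keeps \<open>\<delta> * \<tau> \<le> 1 / 2\<close> on the box, so the
    denominators \<open>1 - \<delta> * \<tau>\<close> stay away from 0.\<close>
  define T where "T = 1 / (2 * K)"
  have "T > 0" using assms by (simp add: T_def)
  define A :: "real \<times> real \<times> real \<Rightarrow> real" where "A = (\<lambda>(\<delta>, y, \<tau>).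
    crossing_prob (\<delta> * sqrt (1 - \<delta> * \<tau> + y * \<tau>) / (1 - \<delta> * \<tau>))
      (y / ((1 - \<delta> * \<tau>) * sqrt (1 - \<delta> * \<tau> + y * \<tau>))))"
  let ?B = "{0..K} \<times> {\<eta>..Y} \<times> {0..T}"
  have le: "\<delta> * \<tau> \<le> 1 / 2" if "\<delta> \<in> {0..K}" "\<tau> \<in> {0..T}" for \<delta> \<tau>
  proof -
    have "\<delta> * \<tau> \<le> K * T" using that assms by (intro mult_mono) auto
    then show ?thesis using assms by (simp add: T_def)
  qed
  have "continuous_on ?B A"
  proof -
    have "1 - \<delta> * \<tau> \<noteq> 0 \<and> 1 - \<delta> * \<tau> + y * \<tau> > 0" if "(\<delta>, y, \<tau>) \<in> ?B" for \<delta> y \<tau>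
    proof -
      have "y * \<tau> \<ge> 0" using that assms by simp
      with le[of \<delta> \<tau>] that show ?thesis by force
    qed
    then show ?thesis
      unfolding A_def case_prod_unfold
      by (intro continuous_intros) (force simp: split_paired_all)+
  qed
  then have "uniformly_continuous_on ?B A"
    by (intro compact_uniformly_continuous compact_Times compact_Icc)
  moreover have "\<epsilon> / 2 > 0" using assms by simp
  ultimately obtain d where d: "d > 0"
    "\<And>z z'. z \<in> ?B \<Longrightarrow> z' \<in> ?B \<Longrightarrow> dist z' z < d \<Longrightarrow> dist (A z') (A z) < \<epsilon> / 2"
    unfolding uniformly_continuous_on_def by metis
  have "\<forall>\<^sub>F \<tau> in at_right 0. \<tau> \<in> {0<..<min d T}"
    using \<open>d > 0\<close> \<open>T > 0\<close> by (intro eventually_at_right_real) auto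
  moreover have "((\<lambda>\<tau>. 2 * std_normal_cdf (- sqrt (\<eta> / \<tau>) / 2)) \<longlongrightarrow> 2 * 0) (at_right 0)"
  proof -
    have "filterlim (\<lambda>\<tau>. - sqrt (\<eta> / \<tau>) / 2) at_bot (at_right 0)"
      using \<open>\<eta> > 0\<close> by real_asymp
    then show ?thesis
      by (intro tendsto_mult tendsto_const filterlim_compose[OF std_normal_cdf_at_bot])
  qed
  then have "\<forall>\<^sub>F \<tau> in at_right 0. 2 * std_normal_cdf (- sqrt (\<eta> / \<tau>) / 2) < \<epsilon> / 2"
    using assms by (intro order_tendstoD(2)[where y = "2 * 0"]) auto
  ultimately show ?thesis
  proof eventually_elim
    case (elim \<tau>)
    show ?case
    proof (intro ballI)
      fix \<delta> y assume \<delta>: "\<delta> \<in> {0..K}" and y: "y \<in> {\<eta>..Y}"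
      have "dist (\<delta>, y, \<tau>) (\<delta>, y, 0) < d"
        using elim by (simp add: dist_Pair_Pair dist_real_def)
      then have "dist (A (\<delta>, y, \<tau>)) (A (\<delta>, y, 0)) < \<epsilon> / 2"
        using \<delta> y elim \<open>T > 0\<close> by (intro d) auto
      then have 1: "\<bar>A (\<delta>, y, \<tau>) - crossing_prob \<delta> y\<bar> < \<epsilon> / 2"
        by (simp add: A_def dist_real_def)
      have "\<delta> * \<tau> \<le> 1 / 2" using le[of \<delta> \<tau>] \<delta> elim by auto
      then have "crossing_prob (\<delta> * \<tau> * (sqrt (y / \<tau>) / (1 - \<delta> * \<tau>))) (sqrt (y / \<tau>) / (1 - \<delta> * \<tau>))
        \<le> 2 * std_normal_cdf (- sqrt (y / \<tau>) / 2)"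
        using \<delta> y elim assms by (intro crossing_prob_start_le) auto
      also have "sqrt (\<eta> / \<tau>) \<le> sqrt (y / \<tau>)"
        using y elim by (simp add: divide_right_mono)
      then have "2 * std_normal_cdf (- sqrt (y / \<tau>) / 2) \<le> 2 * std_normal_cdf (- sqrt (\<eta> / \<tau>) / 2)"
        by (simp add: std_normal_cdf_le)
      finally have "crossing_prob (\<delta> * \<tau> * (sqrt (y / \<tau>) / (1 - \<delta> * \<tau>))) (sqrt (y / \<tau>) / (1 - \<delta> * \<tau>)) < \<epsilon> / 2"
        using elim by simp
      with 1 show "\<bar>scaled_approx \<delta> y \<tau> - crossing_prob \<delta> y\<bar> < \<epsilon>"
        using crossing_prob_pos[of "\<delta> * \<tau> * (sqrt (y / \<tau>) / (1 - \<delta> * \<tau>))" "sqrt (y / \<tau>) / (1 - \<delta> * \<tau>)"]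
        unfolding scaled_approx_def A_def prod.case by linarith
    qed
  qed
qed

text \<open>Uniform continuity of the inverse of \<open>crossing_prob \<delta>\<close>, with one
  modulus for all \<delta>. On the compact set \<open>S\<close> of triples with \<open>y\<close> and
  \<open>z\<close> at least \<epsilon> apart, the gap \<open>f\<close> is continuous and, by strict
  monotonicity, positive; its minimum serves as \<kappa>.\<close>

lemma crossing_prob_separation:
  assumes "0 < \<eta>" "\<epsilon> > 0"
  obtains \<kappa> where "\<kappa> > 0" and "\<And>\<delta> y z. \<delta> \<in> {0..K} \<Longrightarrow> y \<in> {\<eta>..Y} \<Longrightarrow> z \<in> {\<eta>..Y} \<Longrightarrow>
    \<bar>crossing_prob \<delta> y - crossing_prob \<delta> z\<bar> < \<kappa> \<Longrightarrow> \<bar>y - z\<bar> < \<epsilon>"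
proof -
  define S where "S = ({0..K} \<times> {\<eta>..Y} \<times> {\<eta>..Y}) \<inter> {p. \<bar>fst (snd p) - snd (snd p)\<bar> \<ge> \<epsilon>}"
  define f where "f = (\<lambda>p. \<bar>crossing_prob (fst p) (fst (snd p)) - crossing_prob (fst p) (snd (snd p))\<bar>)"
  have "closed {p :: real \<times> real \<times> real. \<bar>fst (snd p) - snd (snd p)\<bar> \<ge> \<epsilon>}"
    by (intro closed_Collect_le continuous_intros)
  then have "compact S"
    unfolding S_def by (intro compact_Int_closed compact_Times compact_Icc)
  have pos: "f p > 0" if "p \<in> S" for p
  proof -
    obtain \<delta> y z where p: "p = (\<delta>, y, z)" by (cases p)
    have "\<delta> \<ge> 0" "y > 0" "z > 0" "y \<noteq> z"
      using that assms by (auto simp: S_def p)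
    then have "crossing_prob \<delta> y \<noteq> crossing_prob \<delta> z"
      using crossing_prob_strict_antimono[of \<delta> y z] crossing_prob_strict_antimono[of \<delta> z y]
      by (cases y z rule: linorder_cases) auto
    then show ?thesis by (simp add: f_def p)
  qed
  have sep: "\<bar>y - z\<bar> < \<epsilon>" if "\<And>p. p \<in> S \<Longrightarrow> \<kappa> \<le> f p" "\<delta> \<in> {0..K}" "y \<in> {\<eta>..Y}" "z \<in> {\<eta>..Y}"
    "\<bar>crossing_prob \<delta> y - crossing_prob \<delta> z\<bar> < \<kappa>" for \<kappa> \<delta> y z
  proof (rule ccontr)
    assume "\<not> \<bar>y - z\<bar> < \<epsilon>"
    then have "\<kappa> \<le> f (\<delta>, y, z)" using that by (intro that(1)) (auto simp: S_def)
    then show False using that(5) by (simp add: f_def)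
  qed
  show ?thesis
  proof (cases "S = {}")
    case True
    then show ?thesis using sep[of 1] by (intro that[of 1]) auto
  next
    case False
    have "continuous_on S f"
      unfolding f_def by (intro continuous_intros)
    then obtain p where "p \<in> S" "\<And>p'. p' \<in> S \<Longrightarrow> f p \<le> f p'"
      using continuous_attains_inf[OF \<open>compact S\<close> False] by blast
    then show ?thesis using pos sep[of "f p"] by (intro that[of "f p"]) auto
  qed
qed

section \<open>Levels: localisation, existence and limit\<close>

text \<open>Localises roots of the limit equation and levels alike between \<eta> and
  \<open>Y\<close>. For levels the lower end needs \<open>v < y / \<tau>\<close>, which keeps the
  subtracted value small and so shuts out the spurious bounded solution.\<close>

lemma levels_bracket:
  assumes "0 < \<alpha>" "\<alpha> < 1" "K > 0"
  obtains v \<eta> Y where "v > 0" "0 < \<eta>" "\<eta> < Y"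
    and "\<And>\<delta> y. \<delta> \<in> {0..K} \<Longrightarrow> y \<le> \<eta> \<Longrightarrow> crossing_prob \<delta> y > \<alpha>"
    and "\<And>\<delta> y. \<delta> \<in> {0..K} \<Longrightarrow> y \<ge> Y \<Longrightarrow> crossing_prob \<delta> y < \<alpha>"
    and "\<forall>\<^sub>F \<tau> in at_right 0. \<forall>\<delta>\<in>{0..K}. \<forall>y>0. y \<le> \<eta> \<longrightarrow> v < y / \<tau> \<longrightarrow> scaled_approx \<delta> y \<tau> > \<alpha>"
    and "\<forall>\<^sub>F \<tau> in at_right 0. \<forall>\<delta>\<in>{0..K}. \<forall>y\<ge>Y. scaled_approx \<delta> y \<tau> < \<alpha>"
proof -
  \<comment> \<open>Two errors of this size will be subtracted from 1, and
    \<open>1 - 2 * \<epsilon> > \<alpha>\<close> still holds because \<alpha> < 1.\<close>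
  define \<epsilon> where "\<epsilon> = (1 - \<alpha>) / 3"
  have "\<epsilon> > 0" using assms by (simp add: \<epsilon>_def)
  have tail: "\<forall>\<^sub>F z in at_top. 2 * std_normal_cdf (f z) < e"
    if "filterlim f at_bot at_top" "e > 0" for f :: "real \<Rightarrow> real" and e
  proof -
    have "((\<lambda>z. 2 * std_normal_cdf (f z)) \<longlongrightarrow> 2 * 0) at_top"
      by (intro tendsto_mult tendsto_const filterlim_compose[OF std_normal_cdf_at_bot] that)
    then show ?thesis using \<open>e > 0\<close> by (intro order_tendstoD(2)) auto
  qed
  have "filterlim (\<lambda>v. - sqrt v / 2) at_bot at_top" by real_asymp
  then have "\<forall>\<^sub>F v in at_top. 2 * std_normal_cdf (- sqrt v / 2) < \<epsilon>"
    using \<open>\<epsilon> > 0\<close> by (rule tail)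
  \<comment> \<open>For \<open>y / \<tau> > v\<close> the value at the lower end of integration is
    then below \<epsilon>, by \<open>crossing_prob_start_le\<close>.\<close>
  then obtain v where v: "v > 0" "2 * std_normal_cdf (- sqrt v / 2) < \<epsilon>"
    using eventually_happens'[OF trivial_limit_at_top_linorder
        eventually_conj[OF eventually_gt_at_top[of 0]]] by blast
  have "\<forall>\<^sub>F y in at_right 0. 2 * std_normal_cdf (- 3 * y) > 1 - \<epsilon>"
  proof -
    have "continuous_on UNIV (\<lambda>y. 2 * std_normal_cdf (- 3 * y))"
      by (intro continuous_intros)
    then have "isCont (\<lambda>y. 2 * std_normal_cdf (- 3 * y)) 0"
      by (simp add: continuous_on_eq_continuous_at)
    then have "((\<lambda>y. 2 * std_normal_cdf (- 3 * y)) \<longlongrightarrow> 1) (at_right 0)"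
      by (auto simp: isCont_def std_normal_cdf_0 intro: filterlim_mono at_le)
    then show ?thesis using \<open>\<epsilon> > 0\<close> by (intro order_tendstoD(1)) auto
  qed
  then obtain \<eta> where \<eta>: "\<eta> > 0" "2 * std_normal_cdf (- 3 * \<eta>) > 1 - \<epsilon>"
    using eventually_happens'[OF trivial_limit_at_right_real
        eventually_conj[OF eventually_at_right_less[of 0]]] by blast
  have "filterlim (\<lambda>Y. - sqrt Y / 6) at_bot at_top" "filterlim (\<lambda>Y. K - Y) at_bot at_top"
    by real_asymp+
  then have "\<forall>\<^sub>F Y in at_top. 2 * std_normal_cdf (- sqrt Y / 6) < \<alpha>"
    "\<forall>\<^sub>F Y in at_top. 2 * std_normal_cdf (K - Y) < \<alpha>"
    using \<open>0 < \<alpha>\<close> by (auto intro: tail)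
  \<comment> \<open>The first two conditions bound \<open>scaled_approx\<close> and
    \<open>crossing_prob\<close> beyond \<open>Y\<close>; \<open>Y > 4 * K\<close> and
    \<open>Y > 1\<close> meet the hypotheses of \<open>scaled_approx_le\<close>.\<close>
  then have "\<forall>\<^sub>F Y in at_top. (2 * std_normal_cdf (- sqrt Y / 6) < \<alpha> \<and> 2 * std_normal_cdf (K - Y) < \<alpha>)
      \<and> (Y > \<eta> \<and> Y > 4 * K \<and> Y > 1)"
    by (intro eventually_conj eventually_gt_at_top)
  then obtain Y where Y: "2 * std_normal_cdf (- sqrt Y / 6) < \<alpha>" "2 * std_normal_cdf (K - Y) < \<alpha>"
    "Y > \<eta>" "Y > 4 * K" "Y > 1"
    using eventually_happens'[OF trivial_limit_at_top_linorder] by blast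
  have small: "\<forall>\<^sub>F \<tau> in at_right 0. \<tau> > 0 \<and> \<tau> \<le> 1 \<and> (\<forall>\<delta>\<in>{0..K}. \<delta> * \<tau> \<le> 1 / 2)"
  proof -
    have "\<forall>\<^sub>F \<tau> in at_right 0. \<tau> \<in> {0<..<min 1 (1 / (2 * K))}"
      using assms by (intro eventually_at_right_real) auto
    then show ?thesis
    proof eventually_elim
      case (elim \<tau>)
      have "\<delta> * \<tau> \<le> K * (1 / (2 * K))" if "\<delta> \<in> {0..K}" for \<delta>
        using that elim by (intro mult_mono) auto
      then show ?case using elim assms by auto
    qed
  qed
  show ?thesis
  proof (rule that)
    show "v > 0" "0 < \<eta>" "\<eta> < Y" by fact+
    show "crossing_prob \<delta> y > \<alpha>" if "\<delta> \<in> {0..K}" "y \<le> \<eta>" for \<delta> y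
    proof (cases "y \<le> 0")
      case True
      then show ?thesis using crossing_prob_ge_1[of \<delta> y] that assms by auto
    next
      case False
      then have "std_normal_cdf (- 3 * \<eta>) \<le> std_normal_cdf (- y)"
        using that \<eta> by (intro std_normal_cdf_le) simp
      moreover have "2 * std_normal_cdf (- y) \<le> crossing_prob \<delta> y"
        using that False by (intro crossing_prob_ge) auto
      moreover have "1 - \<epsilon> > \<alpha>" using assms by (simp add: \<epsilon>_def field_simps)
      ultimately show ?thesis using \<eta> by linarith
    qed
    show "crossing_prob \<delta> y < \<alpha>" if "\<delta> \<in> {0..K}" "y \<ge> Y" for \<delta> y
    proof -
      have "crossing_prob \<delta> y \<le> 2 * std_normal_cdf (\<delta> - y)"
        using that Y by (intro crossing_prob_le) auto
      moreover have "std_normal_cdf (\<delta> - y) \<le> std_normal_cdf (K - Y)"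
        using that by (intro std_normal_cdf_le) auto
      ultimately show ?thesis using Y by linarith
    qed
    show "\<forall>\<^sub>F \<tau> in at_right 0. \<forall>\<delta>\<in>{0..K}. \<forall>y>0. y \<le> \<eta> \<longrightarrow> v < y / \<tau> \<longrightarrow> scaled_approx \<delta> y \<tau> > \<alpha>"
      using small
    proof eventually_elim
      case (elim \<tau>)
      show ?case
      proof (intro ballI allI impI)
        fix \<delta> y assume *: "\<delta> \<in> {0..K}" "0 < y" "y \<le> \<eta>" "v < y / \<tau>"
        have "scaled_approx \<delta> y \<tau> \<ge> 2 * std_normal_cdf (- 3 * y) - 2 * std_normal_cdf (- sqrt (y / \<tau>) / 2)"
          using * elim by (intro scaled_approx_ge) auto
        moreover have "std_normal_cdf (- 3 * \<eta>) \<le> std_normal_cdf (- 3 * y)"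
          using * by (intro std_normal_cdf_le) simp
        moreover have "std_normal_cdf (- sqrt (y / \<tau>) / 2) \<le> std_normal_cdf (- sqrt v / 2)"
          using * by (intro std_normal_cdf_le) simp
        moreover have "1 - \<epsilon> - \<epsilon> > \<alpha>" using assms by (simp add: \<epsilon>_def field_simps)
        ultimately show "scaled_approx \<delta> y \<tau> > \<alpha>" using \<eta> v by linarith
      qed
    qed
    show "\<forall>\<^sub>F \<tau> in at_right 0. \<forall>\<delta>\<in>{0..K}. \<forall>y\<ge>Y. scaled_approx \<delta> y \<tau> < \<alpha>"
      using small
    proof eventually_elim
      case (elim \<tau>)
      show ?case
      proof (intro ballI allI impI)
        fix \<delta> y assume *: "\<delta> \<in> {0..K}" "Y \<le> y"
        have "scaled_approx \<delta> y \<tau> \<le> 2 * std_normal_cdf (- sqrt y / 6)"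
          using * elim Y by (intro scaled_approx_le) auto
        moreover have "std_normal_cdf (- sqrt y / 6) \<le> std_normal_cdf (- sqrt Y / 6)"
          using * by (intro std_normal_cdf_le) simp
        ultimately show "scaled_approx \<delta> y \<tau> < \<alpha>" using Y by linarith
      qed
    qed
  qed
qed

text \<open>Existence is the intermediate value theorem on \<open>{\<eta>..Y}\<close>. For the last
  claim, \<open>crossing_prob \<delta> y\<close> is close to \<alpha> at a level \<open>y\<close> by
  uniform convergence, and \<open>crossing_prob_separation\<close> makes \<open>y\<close> close to
  the root.\<close>

lemma scaled_approx_levels:
  assumes "0 < \<alpha>" "\<alpha> < 1" "K > 0"
  obtains v where "v > 0"
    and "\<And>\<delta>. \<delta> \<in> {0..K} \<Longrightarrow> \<exists>x. crossing_prob \<delta> x = \<alpha>"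
    and "\<And>\<delta> x. \<delta> \<in> {0..K} \<Longrightarrow> crossing_prob \<delta> x = \<alpha> \<Longrightarrow> x > 0"
    and "\<forall>\<^sub>F \<tau> in at_right 0. \<forall>\<delta>\<in>{0..K}. \<exists>y>0. v < y / \<tau> \<and> scaled_approx \<delta> y \<tau> = \<alpha>"
    and "\<And>\<epsilon>. \<epsilon> > 0 \<Longrightarrow> \<forall>\<^sub>F \<tau> in at_right 0. \<forall>\<delta>\<in>{0..K}. \<forall>y>0. \<forall>x.
      v < y / \<tau> \<longrightarrow> scaled_approx \<delta> y \<tau> = \<alpha> \<longrightarrow> crossing_prob \<delta> x = \<alpha> \<longrightarrow> \<bar>y / x - 1\<bar> < \<epsilon>"
proof -
  obtain v \<eta> Y where v: "v > 0" and \<eta>: "0 < \<eta>" and Y: "\<eta> < Y"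
    and cp: "\<And>\<delta> y. \<delta> \<in> {0..K} \<Longrightarrow> y \<le> \<eta> \<Longrightarrow> crossing_prob \<delta> y > \<alpha>"
      "\<And>\<delta> y. \<delta> \<in> {0..K} \<Longrightarrow> y \<ge> Y \<Longrightarrow> crossing_prob \<delta> y < \<alpha>"
    and sa: "\<forall>\<^sub>F \<tau> in at_right 0. \<forall>\<delta>\<in>{0..K}. \<forall>y>0. y \<le> \<eta> \<longrightarrow> v < y / \<tau> \<longrightarrow> scaled_approx \<delta> y \<tau> > \<alpha>"
      "\<forall>\<^sub>F \<tau> in at_right 0. \<forall>\<delta>\<in>{0..K}. \<forall>y\<ge>Y. scaled_approx \<delta> y \<tau> < \<alpha>"
    using levels_bracket[OF assms] by blast
  have root: "x \<in> {\<eta><..<Y}" if "\<delta> \<in> {0..K}" "crossing_prob \<delta> x = \<alpha>" for \<delta> x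
    using cp[of \<delta> x] that by force
  show ?thesis
  proof (rule that)
    show "v > 0" by fact
    show "\<exists>x. crossing_prob \<delta> x = \<alpha>" if "\<delta> \<in> {0..K}" for \<delta>
    proof -
      have "\<exists>x\<ge>\<eta>. x \<le> Y \<and> crossing_prob \<delta> x = \<alpha>"
        using cp[OF that, of \<eta>] cp[OF that, of Y] Y
        by (intro IVT2' continuous_intros) auto
      then show ?thesis by blast
    qed
    show "x > 0" if "\<delta> \<in> {0..K}" "crossing_prob \<delta> x = \<alpha>" for \<delta> x
      using root[OF that] \<eta> by simp
    \<comment> \<open>The bound \<open>\<eta> / v\<close> ensures \<open>v < y / \<tau>\<close> for
      every \<open>y \<ge> \<eta>\<close>, so the level found by continuity lies above the
      threshold.\<close>
    have "\<forall>\<^sub>F \<tau> in at_right 0. \<tau> \<in> {0<..<min (\<eta> / v) (1 / (2 * K))}"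
      using \<eta> v assms by (intro eventually_at_right_real) auto
    then show "\<forall>\<^sub>F \<tau> in at_right 0. \<forall>\<delta>\<in>{0..K}. \<exists>y>0. v < y / \<tau> \<and> scaled_approx \<delta> y \<tau> = \<alpha>"
      using sa
    proof eventually_elim
      case (elim \<tau>)
      then have \<tau>: "\<tau> > 0" "v < \<eta> / \<tau>"
        using v by (auto simp: field_simps)
      show ?case
      proof
        fix \<delta> assume \<delta>: "\<delta> \<in> {0..K}"
        have "\<delta> * \<tau> \<le> K * \<tau>" using \<delta> \<tau> by (intro mult_right_mono) auto
        also have "\<dots> < 1" using elim assms by (auto simp: field_simps)
        finally have "\<delta> * \<tau> < 1" .
        moreover have "1 - \<delta> * \<tau> + y * \<tau> > 0" if "y \<ge> \<eta>" for y
          using \<open>\<delta> * \<tau> < 1\<close> that \<eta> \<tau> by (intro add_pos_nonneg) auto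
        ultimately have "continuous_on {\<eta>..Y} (\<lambda>y. scaled_approx \<delta> y \<tau>)"
          unfolding scaled_approx_def using \<tau>
          by (intro continuous_intros) force+
        moreover have "scaled_approx \<delta> \<eta> \<tau> > \<alpha>" "scaled_approx \<delta> Y \<tau> < \<alpha>"
          using elim \<delta> \<tau> \<eta> by auto
        ultimately have "\<exists>y\<ge>\<eta>. y \<le> Y \<and> scaled_approx \<delta> y \<tau> = \<alpha>"
          using Y by (intro IVT2') auto
        then obtain y where y: "y \<ge> \<eta>" "scaled_approx \<delta> y \<tau> = \<alpha>" by blast
        moreover have "v < y / \<tau>"
          using \<tau> divide_right_mono[OF y(1), of \<tau>] by simp
        ultimately show "\<exists>y>0. v < y / \<tau> \<and> scaled_approx \<delta> y \<tau> = \<alpha>"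
          using \<eta> by (intro exI[of _ y]) auto
      qed
    qed
    show "\<forall>\<^sub>F \<tau> in at_right 0. \<forall>\<delta>\<in>{0..K}. \<forall>y>0. \<forall>x.
      v < y / \<tau> \<longrightarrow> scaled_approx \<delta> y \<tau> = \<alpha> \<longrightarrow> crossing_prob \<delta> x = \<alpha> \<longrightarrow> \<bar>y / x - 1\<bar> < \<epsilon>"
      if "\<epsilon> > 0" for \<epsilon>
    proof -
      \<comment> \<open>Since every root exceeds \<eta>, an absolute error below
        \<open>\<epsilon> * \<eta>\<close> is a relative error below \<epsilon>.\<close>
      have "\<epsilon> * \<eta> > 0" using that \<eta> by simp
      then obtain \<kappa> where \<kappa>: "\<kappa> > 0" "\<And>\<delta> y z. \<delta> \<in> {0..K} \<Longrightarrow> y \<in> {\<eta>..Y} \<Longrightarrow> z \<in> {\<eta>..Y} \<Longrightarrow>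
        \<bar>crossing_prob \<delta> y - crossing_prob \<delta> z\<bar> < \<kappa> \<Longrightarrow> \<bar>y - z\<bar> < \<epsilon> * \<eta>"
        using crossing_prob_separation[OF \<eta>, of "\<epsilon> * \<eta>" K Y] by blast
      show ?thesis
        using scaled_approx_uniform_limit[OF assms(3) \<eta> \<kappa>(1), of Y] sa
      proof eventually_elim
        case (elim \<tau>)
        show ?case
        proof (intro ballI allI impI)
          fix \<delta> y x assume *: "\<delta> \<in> {0..K}" "0 < y" "v < y / \<tau>"
            "scaled_approx \<delta> y \<tau> = \<alpha>" "crossing_prob \<delta> x = \<alpha>"
          \<comment> \<open>Outside this interval the inequalities from \<open>sa\<close> contradict
            \<open>scaled_approx \<delta> y \<tau> = \<alpha>\<close>.\<close>
          have y: "y \<in> {\<eta>..Y}"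
            using elim * by (smt (verit) atLeastAtMost_iff)
          have x: "x > \<eta>" "x < Y" using root * by auto
          have "\<bar>\<alpha> - crossing_prob \<delta> y\<bar> < \<kappa>"
            using elim(1) * y by auto
          then have "\<bar>y - x\<bar> < \<epsilon> * \<eta>"
            using * y x by (intro \<kappa>(2)[of \<delta>]) auto
          also have "\<dots> \<le> \<epsilon> * x" using x that by simp
          finally have "\<bar>y - x\<bar> / x < \<epsilon>"
            using x \<eta> by (simp add: pos_divide_less_eq)
          moreover have "y / x - 1 = (y - x) / x"
            using x \<eta> by (simp add: field_simps)
          ultimately show "\<bar>y / x - 1\<bar> < \<epsilon>"
            using x \<eta> by simp
        qed
      qed
    qed
  qed
qed

section \<open>Transfer to the original coordinates\<close>

text \<open>The threshold \<open>u\<^sub>0\<close>, fixed before \<open>t\<close>, \<delta> and the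
  selection of levels, excludes the spurious solution; existence of levels above it keeps the
  asymptotic claim from being vacuous. The o(1) is read uniformly in \<delta>, as the relative error
  \<open>r\<close>.\<close>

theorem theorem6p6:
  fixes M D \<alpha> K :: real
  assumes "M > 0" and "D > 0" and "0 < \<alpha>" and "\<alpha> < 1" and "K > 0"
  shows "(\<forall>\<delta>\<in>{0..<K}. \<exists>x. solves_limit_eq \<alpha> \<delta> x) \<and>
    (\<exists>u\<^sub>0>0.
      (\<forall>\<^sub>F t in at_top. \<forall>\<delta>\<in>{0..<K}.
         \<exists>u>u\<^sub>0. is_fixed_prob_level M D \<alpha> t (c_near_crit M D t \<delta>) u) \<and>
      (\<forall>(u :: real \<Rightarrow> real \<Rightarrow> real) (x :: real \<Rightarrow> real).
         (\<forall>\<^sub>F t in at_top. \<forall>\<delta>\<in>{0..<K}.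
            u t (c_near_crit M D t \<delta>) > u\<^sub>0 \<and>
            is_fixed_prob_level M D \<alpha> t (c_near_crit M D t \<delta>) (u t (c_near_crit M D t \<delta>))) \<longrightarrow>
         (\<forall>\<delta>\<in>{0..<K}. solves_limit_eq \<alpha> \<delta> (x \<delta>)) \<longrightarrow>
         (\<exists>r :: real \<Rightarrow> real \<Rightarrow> real.
            uniform_limit {0..<K} r (\<lambda>_. 0) at_top \<and>
            (\<forall>\<^sub>F t in at_top. \<forall>\<delta>\<in>{0..<K}.
               u t (c_near_crit M D t \<delta>) = D / M powr (3/2) * x \<delta> * sqrt t * (1 + r t \<delta>)))))"
proof -
  obtain v where v: "v > 0"
    and ex_root: "\<And>\<delta>. \<delta> \<in> {0..K} \<Longrightarrow> \<exists>x. crossing_prob \<delta> x = \<alpha>"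
    and root_pos: "\<And>\<delta> x. \<delta> \<in> {0..K} \<Longrightarrow> crossing_prob \<delta> x = \<alpha> \<Longrightarrow> x > 0"
    and ex_level: "\<forall>\<^sub>F \<tau> in at_right 0. \<forall>\<delta>\<in>{0..K}. \<exists>y>0. v < y / \<tau> \<and> scaled_approx \<delta> y \<tau> = \<alpha>"
    and level_lim: "\<And>\<epsilon>. \<epsilon> > 0 \<Longrightarrow> \<forall>\<^sub>F \<tau> in at_right 0. \<forall>\<delta>\<in>{0..K}. \<forall>y>0. \<forall>x.
      v < y / \<tau> \<longrightarrow> scaled_approx \<delta> y \<tau> = \<alpha> \<longrightarrow> crossing_prob \<delta> x = \<alpha> \<longrightarrow> \<bar>y / x - 1\<bar> < \<epsilon>"
    using scaled_approx_levels[OF assms(3-5)] by blast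
  define \<tau> where "\<tau> t = D / sqrt (M * t)" for t
  define Y where "Y t u = M\<^sup>2 * u * \<tau> t / D\<^sup>2" for t u
  \<comment> \<open>The value of \<open>u\<close> at which
    \<open>y / \<tau> = (M / D)\<^sup>2 * u\<close> equals \<open>v\<close>.\<close>
  define u\<^sub>0 where "u\<^sub>0 = v * D\<^sup>2 / M\<^sup>2"
  have "u\<^sub>0 > 0" using v assms by (simp add: u\<^sub>0_def)
  have lim: "filterlim \<tau> (at_right 0) at_top"
    unfolding \<tau>_def using assms by real_asymp
  have small: "\<forall>\<^sub>F t in at_top. t > 0 \<and> \<tau> t > 0 \<and> (\<forall>\<delta>\<in>{0..K}. \<delta> * \<tau> t < 1)"
  proof -
    have "\<forall>\<^sub>F s in at_right 0. s \<in> {0<..<1 / K}"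
      using assms by (intro eventually_at_right_real) auto
    then have "\<forall>\<^sub>F t in at_top. \<tau> t \<in> {0<..<1 / K}"
      using lim by (rule eventually_compose_filterlim)
    then show ?thesis
      using eventually_gt_at_top[of 0]
    proof eventually_elim
      case (elim t)
      have "\<delta> * \<tau> t < 1" if "\<delta> \<in> {0..K}" for \<delta>
      proof -
        have "\<delta> * \<tau> t \<le> K * \<tau> t" using that elim by (intro mult_right_mono) auto
        also have "\<dots> < 1" using elim assms by (auto simp: field_simps)
        finally show ?thesis .
      qed
      then show ?case using elim by auto
    qed
  qed
  have Y_div: "Y t u / \<tau> t > v \<longleftrightarrow> u > u\<^sub>0" if "\<tau> t > 0" for t u
    using that assms by (simp add: Y_def u\<^sub>0_def field_simps)
  have level_iff: "is_fixed_prob_level M D \<alpha> t (c_near_crit M D t \<delta>) u \<longleftrightarrow>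
      scaled_approx \<delta> (Y t u) (\<tau> t) = \<alpha>"
    if "t > 0" "u > 0" "\<delta> * \<tau> t < 1" for t u \<delta>
    using that assms inv_gauss_approx_eq_scaled_approx[of M D t u \<delta>]
    by (simp add: is_fixed_prob_level_def Y_def \<tau>_def)
  have Y_scale: "u = D / M powr (3/2) * Y t u * sqrt t" if "t > 0" for t u
  proof -
    have "D / M powr (3/2) * Y t u * sqrt t = M * u / (sqrt M * sqrt M)"
      using assms that by (simp add: powr_three_halves Y_def \<tau>_def real_sqrt_mult field_simps power2_eq_square)
    then show ?thesis using assms by simp
  qed
  have "\<forall>\<^sub>F t in at_top. \<forall>\<delta>\<in>{0..<K}.
      \<exists>u>u\<^sub>0. is_fixed_prob_level M D \<alpha> t (c_near_crit M D t \<delta>) u"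
    using eventually_compose_filterlim[OF ex_level lim] small
  proof eventually_elim
    case (elim t)
    show ?case
    proof
      fix \<delta> assume "\<delta> \<in> {0..<K}"
      then have \<delta>: "\<delta> \<in> {0..K}" by simp
      then obtain y where y: "v < y / \<tau> t" "scaled_approx \<delta> y (\<tau> t) = \<alpha>"
        using elim by blast
      \<comment> \<open>The inverse of \<open>Y t\<close> at \<open>y\<close>.\<close>
      define u where "u = D\<^sup>2 * y / (M\<^sup>2 * \<tau> t)"
      have "Y t u = y" using assms elim by (simp add: Y_def u_def)
      then have "u > u\<^sub>0" using Y_div[of t u] y elim by simp
      moreover have "is_fixed_prob_level M D \<alpha> t (c_near_crit M D t \<delta>) u"
        using level_iff[of t u \<delta>] elim \<delta> \<open>u > u\<^sub>0\<close> \<open>u\<^sub>0 > 0\<close> \<open>Y t u = y\<close> y by auto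
      ultimately show "\<exists>u>u\<^sub>0. is_fixed_prob_level M D \<alpha> t (c_near_crit M D t \<delta>) u"
        by blast
    qed
  qed
  moreover have "\<exists>r :: real \<Rightarrow> real \<Rightarrow> real. uniform_limit {0..<K} r (\<lambda>_. 0) at_top \<and>
      (\<forall>\<^sub>F t in at_top. \<forall>\<delta>\<in>{0..<K}.
        u t (c_near_crit M D t \<delta>) = D / M powr (3/2) * x \<delta> * sqrt t * (1 + r t \<delta>))"
    if u: "\<forall>\<^sub>F t in at_top. \<forall>\<delta>\<in>{0..<K}. u t (c_near_crit M D t \<delta>) > u\<^sub>0 \<and>
        is_fixed_prob_level M D \<alpha> t (c_near_crit M D t \<delta>) (u t (c_near_crit M D t \<delta>))"
      and x: "\<forall>\<delta>\<in>{0..<K}. solves_limit_eq \<alpha> \<delta> (x \<delta>)"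
    for u :: "real \<Rightarrow> real \<Rightarrow> real" and x :: "real \<Rightarrow> real"
  proof -
    have x: "crossing_prob \<delta> (x \<delta>) = \<alpha>" if "\<delta> \<in> {0..<K}" for \<delta>
      using x that by (simp add: solves_limit_eq_iff)
    \<comment> \<open>The relative error of the rescaled level against the root, which is positive
      by \<open>root_pos\<close>; \<open>Y_scale\<close> then gives the claimed formula.\<close>
    define r where "r t \<delta> = Y t (u t (c_near_crit M D t \<delta>)) / x \<delta> - 1" for t \<delta>
    have "uniform_limit {0..<K} r (\<lambda>_. 0) at_top"
    proof (rule uniform_limitI)
      fix \<epsilon> :: real assume "\<epsilon> > 0"
      show "\<forall>\<^sub>F t in at_top. \<forall>\<delta>\<in>{0..<K}. dist (r t \<delta>) 0 < \<epsilon>"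
        using eventually_compose_filterlim[OF level_lim[OF \<open>\<epsilon> > 0\<close>] lim] u small
      proof eventually_elim
        case (elim t)
        show ?case
        proof
          fix \<delta> assume \<delta>: "\<delta> \<in> {0..<K}"
          let ?u = "u t (c_near_crit M D t \<delta>)"
          have "?u > u\<^sub>0" using elim(2) \<delta> by blast
          then have "?u > 0" using \<open>u\<^sub>0 > 0\<close> by simp
          then have "Y t ?u > 0" using elim assms by (simp add: Y_def)
          moreover have "v < Y t ?u / \<tau> t" using Y_div[of t ?u] elim \<open>?u > u\<^sub>0\<close> by simp
          moreover have "scaled_approx \<delta> (Y t ?u) (\<tau> t) = \<alpha>"
            using level_iff[of t ?u \<delta>] elim \<delta> \<open>?u > 0\<close> by auto
          ultimately have "\<bar>Y t ?u / x \<delta> - 1\<bar> < \<epsilon>"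
            using elim(1)[rule_format, of \<delta> "Y t ?u" "x \<delta>"] x[OF \<delta>] \<delta> by simp
          then show "dist (r t \<delta>) 0 < \<epsilon>"
            by (simp add: r_def)
        qed
      qed
    qed
    moreover have "\<forall>\<^sub>F t in at_top. \<forall>\<delta>\<in>{0..<K}.
        u t (c_near_crit M D t \<delta>) = D / M powr (3/2) * x \<delta> * sqrt t * (1 + r t \<delta>)"
      using eventually_gt_at_top[of 0]
    proof eventually_elim
      case (elim t)
      show ?case
      proof
        fix \<delta> assume \<delta>: "\<delta> \<in> {0..<K}"
        let ?u = "u t (c_near_crit M D t \<delta>)"
        have "x \<delta> > 0" using root_pos[OF _ x[OF \<delta>]] \<delta> by simp
        then have "Y t ?u = x \<delta> * (1 + r t \<delta>)"
          by (simp add: r_def)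
        then show "?u = D / M powr (3/2) * x \<delta> * sqrt t * (1 + r t \<delta>)"
          using Y_scale[OF elim, of ?u] by (simp add: mult_ac)
      qed
    qed
    ultimately show ?thesis by blast
  qed
  ultimately show ?thesis
    using \<open>u\<^sub>0 > 0\<close> ex_root by (auto simp: solves_limit_eq_iff intro!: exI[of _ u\<^sub>0])
qed

end
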